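(* Let $k\ge3$ and $0\le\alpha<1$. Let $G$ be a connected $k$-uniform hypergraph on $n$ vertices with Perron vector $u\in\mathbb{R}_+^n$ corresponding to $\rho_\alpha(G)$. Let $H$ be a connected $d$-regular $k$-uniform hypergraph on $m$ vertices and let $\widetilde{G}=G\times H$ be the direct product of $G$ and $H$. Then $\rho_\alpha(\widetilde{G})=(k-1)!\,d\,\rho_\alpha(G)$, and $u\otimes e$ is an eigenvector of $\mathcal{A}_\alpha(\widetilde{G})$ corresponding to $\rho_\alpha(\widetilde{G})$, where $e=(1,1,\dots,1)^T\in\mathbb{R}^m$.
   Context: A $k$-uniform hypergraph $G=(V(G),E(G))$ has a finite vertex set $V(G)$ (identified with $[n]=\{1,\dots,n\}$) and an edge set $E(G)$ consisting of distinct $k$-element subsets of $V(G)$; hypergraphs are assumed to have at least one edge. The degree $d_i$ of a vertex $i$ is the number of edges containing $i$; $H$ is $d$-regular if every vertex of $H$ has degree $d$. $G$ is connected if every two vertices $u,v$ are joined by a sequence $u=v_1,e_1,v_2,\dots,e_\ell,v_{\ell+1}=v$ with $e_t\in E(G)$ and $\{v_t,v_{t+1}\}\subseteq e_t$. The direct product $G\times H$ of two $k$-uniform hypergraphs has vertex set $V(G)\times V(H)$, and $\{(i_1,j_1),\dots,(i_k,j_k)\}$ is an edge of $G\times H$ if and only if $\{i_1,\dots,i_k\}\in E(G)$ and $\{j_1,\dots,j_k\}\in E(H)$. For $u\in\mathbb{R}^n$, $v\in\mathbb{R}^m$, $u\otimes v$ is the vector indexed by $[n]\times[m]$ with $(u\otimes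 v)_{(i,j)}=u_iv_j$. The adjacency tensor $\mathcal{A}(G)$ is the tensor of order $k$ and dimension $n$ with entries $a_{i_1\ldots i_k}=\frac{1}{(k-1)!}$ if $\{i_1,\dots,i_k\}\in E(G)$ and $0$ otherwise; $\mathcal{D}(G)$ is the diagonal tensor of order $k$ and dimension $n$ with diagonal entries $d_{i\ldots i}=d_i$ and all other entries $0$. For $0\le\alpha<1$, $\mathcal{A}_\alpha(G)=\alpha\mathcal{D}(G)+(1-\alpha)\mathcal{A}(G)$. For a tensor $\mathcal{T}=(t_{i_1\ldots i_k})$ of order $k$ and dimension $n$ and $x\in\mathbb{C}^n$, $(\mathcal{T}x)_i=\sum_{i_2,\dots,i_k=1}^n t_{ii_2\ldots i_k}x_{i_2}\cdots x_{i_k}$. A number $\lambda\in\mathbb{C}$ is an eigenvalue of $\mathcal{T}$ with eigenvector $0\ne x\in\mathbb{C}^n$ if $(\mathcal{T}x)_i=\lambda x_i^{k-1}$ for all $i$; the spectral radius $\rho(\mathcal{T})$ is the maximum of $|\lambda|$ over eigenvalues $\lambda$ of $\mathcal{T}$. $\rho_\alpha(G)=\rho(\mathcal{A}_\alpha(G))$. $\mathbb{R}_+^n$ denotes the set of nonnegative real vectors of dimension $n$; a Perron vector corresponding to $\rho_\alpha(G)$ is a nonnegative eigenvector of $\mathcal{A}_\alpha(G)$ for the eigenvalue $\rho_\alpha(G)$. *)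

theory Defs
  imports "HOL-Analysis.Analysis"
begin

text \<open>
  The vertex set of a hypergraph is an arbitrary finite index type, playing the role of
  \<open>{1..n}\<close>, so that a hypergraph is given by its edge set and vectors over the vertices are
  finite Cartesian products. The direct product lives on the product type.
\<close>

definition uniform_hypergraph :: "nat \<Rightarrow> 'v::finite set set \<Rightarrow> bool" where
  "uniform_hypergraph k E \<longleftrightarrow> E \<noteq> {} \<and> (\<forall>e\<in>E. card e = k)"

definition vertex_degree :: "'v::finite set set \<Rightarrow> 'v \<Rightarrow> nat" where
  "vertex_degree E v = card {e \<in> E. v \<in> e}"

definition regular_hypergraph :: "nat \<Rightarrow> 'v::finite set set \<Rightarrow> bool" where
  "regular_hypergraph d E \<longleftrightarrow> (\<forall>v. vertex_degree E v = d)"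

definition connected_hypergraph :: "'v::finite set set \<Rightarrow> bool" where
  "connected_hypergraph E \<longleftrightarrow> (\<forall>u v. (u, v) \<in> {(x, y). \<exists>e\<in>E. {x, y} \<subseteq> e}\<^sup>*)"

definition direct_product ::
    "nat \<Rightarrow> 'v::finite set set \<Rightarrow> 'w::finite set set \<Rightarrow> ('v \<times> 'w) set set" where
  "direct_product k E F =
     {(\<lambda>t. (i t, j t)) ` {1..k} | i j. i ` {1..k} \<in> E \<and> j ` {1..k} \<in> F}"

text \<open>
  A tensor of order \<open>k\<close> is a function on index lists; only its values on lists
  of length \<open>k\<close> matter.
\<close>

type_synonym 'v tensor = "'v list \<Rightarrow> complex"

definition tensor_apply :: "nat \<Rightarrow> 'v::finite tensor \<Rightarrow> complex^'v \<Rightarrow> complex^'v" where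
  "tensor_apply k T x =
     (\<chi> i. \<Sum>is | length is = k - 1. T (i # is) * (\<Prod>j\<leftarrow>is. x $ j))"

definition tensor_eigenvector ::
    "nat \<Rightarrow> 'v::finite tensor \<Rightarrow> complex \<Rightarrow> complex^'v \<Rightarrow> bool" where
  "tensor_eigenvector k T l x \<longleftrightarrow>
     x \<noteq> 0 \<and> (\<forall>i. tensor_apply k T x $ i = l * (x $ i) ^ (k - 1))"

definition tensor_eigenvalue :: "nat \<Rightarrow> 'v::finite tensor \<Rightarrow> complex \<Rightarrow> bool" where
  "tensor_eigenvalue k T l \<longleftrightarrow> (\<exists>x. tensor_eigenvector k T l x)"

text \<open>
  The maximum is rendered by \<open>GREATEST\<close> because \<^const>\<open>Max\<close> is only meaningful
  for sets already known to be finite.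
\<close>

definition tensor_spectral_radius :: "nat \<Rightarrow> 'v::finite tensor \<Rightarrow> real" where
  "tensor_spectral_radius k T = (GREATEST r. \<exists>l. tensor_eigenvalue k T l \<and> r = cmod l)"

text \<open>
  In a \<open>k\<close>-uniform hypergraph, an index list of length \<open>k\<close> whose set of entries is an edge
  is automatically distinct.
\<close>

definition adjacency_tensor :: "nat \<Rightarrow> 'v::finite set set \<Rightarrow> 'v tensor" where
  "adjacency_tensor k E = (\<lambda>is. if set is \<in> E then 1 / fact (k - 1) else 0)"

definition degree_tensor :: "nat \<Rightarrow> 'v::finite set set \<Rightarrow> 'v tensor" where
  "degree_tensor k E =
     (\<lambda>is. if is = replicate k (hd is) then of_nat (vertex_degree E (hd is)) else 0)"

definition alpha_tensor :: "nat \<Rightarrow> real \<Rightarrow> 'v::finite set set \<Rightarrow> 'v tensor" where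
  "alpha_tensor k \<alpha> E = (\<lambda>is. complex_of_real \<alpha> * degree_tensor k E is
     + complex_of_real (1 - \<alpha>) * adjacency_tensor k E is)"

definition alpha_spectral_radius :: "nat \<Rightarrow> real \<Rightarrow> 'v::finite set set \<Rightarrow> real" where
  "alpha_spectral_radius k \<alpha> E = tensor_spectral_radius k (alpha_tensor k \<alpha> E)"

definition complex_vec :: "real^'v::finite \<Rightarrow> complex^'v" where
  "complex_vec x = (\<chi> i. complex_of_real (x $ i))"

definition perron_vector :: "nat \<Rightarrow> real \<Rightarrow> 'v::finite set set \<Rightarrow> real^'v \<Rightarrow> bool" where
  "perron_vector k \<alpha> E u \<longleftrightarrow> (\<forall>i. 0 \<le> u $ i) \<and>
     tensor_eigenvector k (alpha_tensor k \<alpha> E)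
       (complex_of_real (alpha_spectral_radius k \<alpha> E)) (complex_vec u)"

definition vec_tensor :: "real^'v::finite \<Rightarrow> real^'w::finite \<Rightarrow> real^('v \<times> 'w)" where
  "vec_tensor u v = (\<chi> p. u $ fst p * v $ snd p)"

end

theory Submission
  imports Defs "HOL-Combinatorics.Multiset_Permutations"
begin

text \<open>
  For the symmetric tensor \<open>\<A>\<^sub>\<alpha>(G)\<close>, maximise the form \<open>x\<^sup>T \<A>\<^sub>\<alpha>(G) x\<close> over
  the nonnegative vectors with \<open>\<Sum> x\<^sub>i\<^sup>k = 1\<close>. Since \<open>G\<close> is connected, every maximiser is
  positive: raising all zero entries to \<open>\<epsilon>\<close> gains a term of order at least \<open>\<epsilon>\<^bsup>k-1\<^esup>\<close> from an
  edge that contains both zero and nonzero entries, and costs only order \<open>\<epsilon>\<^sup>k\<close>. So a maximiser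
  is a positive eigenvector, and a positive eigenvector always belongs to the spectral radius.
  Hence the Perron vector \<open>u\<close> is itself a maximiser and therefore positive. Then
  \<open>u \<otimes> e\<close> is a positive eigenvector of \<open>\<A>\<^sub>\<alpha>(G \<times> H)\<close>, which identifies
  the spectral radius of the product.
\<close>

section \<open>Link sums and the action of the tensor\<close>

text \<open>This is the partial derivative, with respect to \<open>f i\<close>, of the edge
  polynomial that sums the products of \<open>f\<close> along the edges. The field is left general
  because complex eigenvectors are compared with real vectors.\<close>

definition link_sum :: "'v::finite set set \<Rightarrow> ('v \<Rightarrow> 'a::field_char_0) \<Rightarrow> 'v \<Rightarrow> 'a" where
  "link_sum E f i = (\<Sum>e | e \<in> E \<and> i \<in> e. \<Prod>j\<in>e - {i}. f j)"

lemma link_sum_1: "link_sum E (\<lambda>_. 1) i = of_nat (vertex_degree E i)"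
  by (simp add: link_sum_def vertex_degree_def)

lemma link_sum_nonneg: "(\<And>i. 0 \<le> f i) \<Longrightarrow> 0 \<le> link_sum E f i" for f :: "_ \<Rightarrow> real"
  by (simp add: link_sum_def sum_nonneg prod_nonneg)

lemma link_sum_mono:
  fixes f :: "'v::finite \<Rightarrow> real"
  assumes "\<And>i. 0 \<le> f i" "\<And>i. f i \<le> g i"
  shows "link_sum E f i \<le> link_sum E g i"
  unfolding link_sum_def by (intro sum_mono prod_mono) (use assms in auto)

lemma link_sum_scale:
  assumes "uniform_hypergraph k E"
  shows "link_sum E (\<lambda>j. c * f j) i = c ^ (k - 1) * link_sum E f i"
  unfolding link_sum_def sum_distrib_left
  by (intro sum.cong) (use assms in \<open>auto simp: prod.distrib uniform_hypergraph_def\<close>)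

lemma norm_link_sum_le:
  fixes f :: "'v::finite \<Rightarrow> 'a::{real_normed_field,field_char_0}"
  shows "norm (link_sum E f i) \<le> link_sum E (\<lambda>j. norm (f j)) i"
  unfolding link_sum_def by (rule order_trans[OF norm_sum]) (simp add: prod_norm)

text \<open>Euler's identity for a form of degree \<open>k\<close>: each edge product is counted
  once from each of its \<open>k\<close> vertices.\<close>

lemma sum_mult_link_sum:
  assumes "uniform_hypergraph k E"
  shows "(\<Sum>i\<in>UNIV. f i * link_sum E f i) = of_nat k * (\<Sum>e\<in>E. \<Prod>j\<in>e. f j)"
proof -
  have "(\<Sum>i\<in>UNIV. f i * link_sum E f i) = (\<Sum>i\<in>UNIV. \<Sum>e | e \<in> E \<and> i \<in> e. \<Prod>j\<in>e. f j)"
    unfolding link_sum_def sum_distrib_left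
    by (intro sum.cong refl) (simp flip: prod.remove)
  also have "\<dots> = (\<Sum>i\<in>UNIV. \<Sum>e\<in>E. if i \<in> e then \<Prod>j\<in>e. f j else 0)"
    by (simp add: sum.If_cases Int_def)
  also have "\<dots> = (\<Sum>e\<in>E. \<Sum>i\<in>UNIV. if i \<in> e then \<Prod>j\<in>e. f j else 0)"
    by (rule sum.swap)
  also have "\<dots> = (\<Sum>e\<in>E. of_nat k * (\<Prod>j\<in>e. f j))"
    by (intro sum.cong) (use assms in \<open>auto simp: sum.If_cases uniform_hypergraph_def\<close>)
  finally show ?thesis by (simp add: sum_distrib_left)
qed

text \<open>A list of length \<open>k\<close> whose entries form a set of size \<open>k\<close> has
  no repetition, so each edge \<open>e\<close> through \<open>i\<close> is met once per ordering of
  \<open>e - {i}\<close>. The resulting factorial cancels the normalisation of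
  \<open>adjacency_tensor\<close>.\<close>

lemma sum_lists_edges:
  fixes f :: "'v::finite \<Rightarrow> 'a::field_char_0"
  assumes "uniform_hypergraph k E" "0 < k"
  shows "(\<Sum>is | length is = k - 1 \<and> set (i # is) \<in> E. \<Prod>j\<leftarrow>is. f j)
    = fact (k - 1) * link_sum E f i"
proof -
  have lists: "{is. length is = k - 1 \<and> set (i # is) \<in> E}
      = (\<Union>e\<in>{e. e \<in> E \<and> i \<in> e}. permutations_of_set (e - {i}))"
  proof (intro set_eqI iffI)
    fix xs assume "xs \<in> {is. length is = k - 1 \<and> set (i # is) \<in> E}"
    then have xs: "length xs = k - 1" "set (i # xs) \<in> E" by auto
    then have "card (set (i # xs)) = length (i # xs)"
      using assms unfolding uniform_hypergraph_def by simp
    then have "distinct (i # xs)" by (rule card_distinct)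
    with xs show "xs \<in> (\<Union>e\<in>{e. e \<in> E \<and> i \<in> e}. permutations_of_set (e - {i}))"
      by (intro UN_I[of "set (i # xs)"]) (auto simp: permutations_of_set_def)
  next
    fix xs assume "xs \<in> (\<Union>e\<in>{e. e \<in> E \<and> i \<in> e}. permutations_of_set (e - {i}))"
    then obtain e where "e \<in> E" "i \<in> e" "set xs = e - {i}" "distinct xs"
      by (auto simp: permutations_of_set_def)
    then show "xs \<in> {is. length is = k - 1 \<and> set (i # is) \<in> E}"
      using assms by (auto simp: distinct_card[symmetric] uniform_hypergraph_def insert_absorb)
  qed
  have "(\<Sum>is | length is = k - 1 \<and> set (i # is) \<in> E. \<Prod>j\<leftarrow>is. f j)
      = (\<Sum>e | e \<in> E \<and> i \<in> e. \<Sum>is\<in>permutations_of_set (e - {i}). \<Prod>j\<leftarrow>is. f j)"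
    unfolding lists
  proof (intro sum.UNION_disjoint ballI impI)
    fix e f assume "e \<in> {e. e \<in> E \<and> i \<in> e}" "f \<in> {e. e \<in> E \<and> i \<in> e}" "e \<noteq> f"
    then have "e - {i} \<noteq> f - {i}" by blast
    then show "permutations_of_set (e - {i}) \<inter> permutations_of_set (f - {i}) = {}"
      by (auto simp: permutations_of_set_def)
  qed auto
  also have "\<dots> = (\<Sum>e | e \<in> E \<and> i \<in> e. fact (k - 1) * (\<Prod>j\<in>e - {i}. f j))"
  proof (intro sum.cong refl)
    fix e assume e: "e \<in> {e. e \<in> E \<and> i \<in> e}"
    have "(\<Sum>is\<in>permutations_of_set (e - {i}). \<Prod>j\<leftarrow>is. f j)
        = (\<Sum>is\<in>permutations_of_set (e - {i}). \<Prod>j\<in>e - {i}. f j)"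
    proof (rule sum.cong)
      fix xs assume "xs \<in> permutations_of_set (e - {i})"
      then have "set xs = e - {i}" "distinct xs" by (auto dest: permutations_of_setD)
      then show "(\<Prod>j\<leftarrow>xs. f j) = (\<Prod>j\<in>e - {i}. f j)"
        using prod.distinct_set_conv_list[of xs f] by (simp only:)
    qed simp
    also have "\<dots> = fact (k - 1) * (\<Prod>j\<in>e - {i}. f j)"
      using e assms by (simp add: uniform_hypergraph_def)
    finally show "(\<Sum>is\<in>permutations_of_set (e - {i}). \<Prod>j\<leftarrow>is. f j)
      = fact (k - 1) * (\<Prod>j\<in>e - {i}. f j)" .
  qed
  finally show ?thesis by (simp add: link_sum_def sum_distrib_left)
qed

lemma tensor_apply_alpha:
  fixes E :: "'v::finite set set"
  assumes "uniform_hypergraph k E" "0 < k"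
  shows "tensor_apply k (alpha_tensor k \<alpha> E) x $ i
    = of_real \<alpha> * of_nat (vertex_degree E i) * (x $ i) ^ (k - 1)
      + of_real (1 - \<alpha>) * link_sum E (($) x) i"
proof -
  let ?L = "{is :: 'v list. length is = k - 1}"
  have fin: "finite ?L"
    using finite_lists_length_eq[of "UNIV :: 'v set" "k - 1"] by simp
  have rep: "i # is = replicate k i \<longleftrightarrow> is = replicate (k - 1) i" for "is"
    using assms(2) by (cases k) auto
  have "(\<Sum>is\<in>?L. degree_tensor k E (i # is) * (\<Prod>j\<leftarrow>is. x $ j))
      = (\<Sum>is\<in>?L. if is = replicate (k - 1) i
           then of_nat (vertex_degree E i) * (x $ i) ^ (k - 1) else 0)"
    by (intro sum.cong refl) (auto simp: degree_tensor_def rep)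
  also have "\<dots> = of_nat (vertex_degree E i) * (x $ i) ^ (k - 1)"
    using fin by (subst sum.delta) auto
  finally have deg: "(\<Sum>is\<in>?L. degree_tensor k E (i # is) * (\<Prod>j\<leftarrow>is. x $ j))
      = of_nat (vertex_degree E i) * (x $ i) ^ (k - 1)" .
  have "(\<Sum>is\<in>?L. adjacency_tensor k E (i # is) * (\<Prod>j\<leftarrow>is. x $ j))
      = (\<Sum>is\<in>?L. if set (i # is) \<in> E then (\<Prod>j\<leftarrow>is. x $ j) / fact (k - 1) else 0)"
    by (intro sum.cong refl) (auto simp: adjacency_tensor_def)
  also have "\<dots> = (\<Sum>is | length is = k - 1 \<and> set (i # is) \<in> E.
      (\<Prod>j\<leftarrow>is. x $ j) / fact (k - 1))"
    using fin by (simp add: sum.If_cases Int_def)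
  also have "\<dots> = link_sum E (($) x) i"
    using sum_lists_edges[OF assms, of "($) x" i] by (simp flip: sum_divide_distrib)
  finally have adj: "(\<Sum>is\<in>?L. adjacency_tensor k E (i # is) * (\<Prod>j\<leftarrow>is. x $ j))
      = link_sum E (($) x) i" .
  have "tensor_apply k (alpha_tensor k \<alpha> E) x $ i
      = of_real \<alpha> * (\<Sum>is\<in>?L. degree_tensor k E (i # is) * (\<Prod>j\<leftarrow>is. x $ j))
      + of_real (1 - \<alpha>) * (\<Sum>is\<in>?L. adjacency_tensor k E (i # is) * (\<Prod>j\<leftarrow>is. x $ j))"
    unfolding tensor_apply_def alpha_tensor_def sum_distrib_left
    by (simp add: algebra_simps flip: sum.distrib)
  then show ?thesis by (simp only: deg adj mult.assoc)
qed

section \<open>Real eigenvectors and the spectral radius\<close>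

lemma tensor_eigenvector_complex_vec_iff:
  assumes "uniform_hypergraph k E" "0 < k"
  shows "tensor_eigenvector k (alpha_tensor k \<alpha> E) (complex_of_real l) (complex_vec x) \<longleftrightarrow>
    x \<noteq> 0 \<and> (\<forall>i. \<alpha> * real (vertex_degree E i) * (x $ i) ^ (k - 1)
      + (1 - \<alpha>) * link_sum E (($) x) i = l * (x $ i) ^ (k - 1))"
proof -
  have "complex_vec x = 0 \<longleftrightarrow> x = 0"
    by (simp add: complex_vec_def vec_eq_iff)
  moreover have vec: "complex_vec x $ j = complex_of_real (x $ j)" for j
    by (simp add: complex_vec_def)
  have "link_sum E (($) (complex_vec x)) i = complex_of_real (link_sum E (($) x) i)" for i
    by (simp add: link_sum_def vec)
  then have "tensor_apply k (alpha_tensor k \<alpha> E) (complex_vec x) $ i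
      = of_real (\<alpha> * real (vertex_degree E i) * (x $ i) ^ (k - 1)
        + (1 - \<alpha>) * link_sum E (($) x) i)" for i
    by (simp add: tensor_apply_alpha[OF assms] vec)
  moreover have "complex_of_real l * (complex_vec x $ i) ^ (k - 1) = of_real (l * (x $ i) ^ (k - 1))"
    for i by (simp add: vec)
  ultimately show ?thesis
    unfolding tensor_eigenvector_def by (simp only: of_real_eq_iff)
qed

text \<open>Compare an arbitrary eigenvector \<open>y\<close> with \<open>x\<close> at an index where \<open>|y\<^sub>i| / x\<^sub>i\<close> is maximal.\<close>

lemma alpha_spectral_radius_eqI:
  fixes E :: "'v::finite set set"
  assumes E: "uniform_hypergraph k E" "0 < k" and \<alpha>: "0 \<le> \<alpha>" "\<alpha> \<le> 1"
    and pos: "\<And>i. 0 < x $ i"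
    and eig: "tensor_eigenvector k (alpha_tensor k \<alpha> E) (complex_of_real l) (complex_vec x)"
  shows "alpha_spectral_radius k \<alpha> E = l"
proof -
  let ?D = "\<lambda>i. \<alpha> * real (vertex_degree E i)"
  have eq: "?D i * (x $ i) ^ (k - 1) + (1 - \<alpha>) * link_sum E (($) x) i = l * (x $ i) ^ (k - 1)" for i
    using eig unfolding tensor_eigenvector_complex_vec_iff[OF E] by blast
  \<comment> \<open>Ensures that the modulus of \<open>l\<close> is \<open>l\<close> itself when
    \<open>l\<close> is shown to be attained.\<close>
  have l: "0 \<le> l"
  proof -
    fix i :: 'v
    have "0 \<le> l * (x $ i) ^ (k - 1)"
      unfolding eq[symmetric] using pos \<alpha> by (simp add: link_sum_nonneg less_imp_le)
    then show ?thesis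
      using pos[of i] by (simp add: zero_le_mult_iff) (meson not_less zero_less_power)
  qed
  have bound: "cmod m \<le> l" if "tensor_eigenvector k (alpha_tensor k \<alpha> E) m y" for m y
  proof -
    define t where "t = Max (range (\<lambda>i. cmod (y $ i) / x $ i))"
    have "t \<in> range (\<lambda>i. cmod (y $ i) / x $ i)"
      unfolding t_def by (rule Max_in) auto
    then obtain i where i: "t = cmod (y $ i) / x $ i" by blast
    have le: "cmod (y $ j) \<le> t * x $ j" for j
    proof -
      have "cmod (y $ j) / x $ j \<le> t" unfolding t_def by (rule Max_ge) auto
      then show ?thesis using pos[of j] by (simp add: field_simps)
    qed
    have "y \<noteq> 0" using that by (simp add: tensor_eigenvector_def)
    then obtain j where "y $ j \<noteq> 0" by (auto simp: vec_eq_iff)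
    then have "0 < t * x $ j" using le[of j] less_le_trans zero_less_norm_iff by blast
    then have "0 < t" using pos[of j] by (simp add: zero_less_mult_iff)
    have yi: "cmod (y $ i) = t * x $ i" using i pos[of i] by simp
    have "cmod m * cmod (y $ i) ^ (k - 1) = cmod (tensor_apply k (alpha_tensor k \<alpha> E) y $ i)"
      using that by (simp add: tensor_eigenvector_def norm_mult norm_power)
    also have "\<dots> \<le> ?D i * cmod (y $ i) ^ (k - 1) + (1 - \<alpha>) * cmod (link_sum E (($) y) i)"
    proof -
      have "cmod (of_real (1 - \<alpha>)) = 1 - \<alpha>" using \<alpha> by (simp only: norm_of_real abs_of_nonneg)
      moreover have "cmod (of_real \<alpha>) = \<alpha>" using \<alpha> by (simp only: norm_of_real abs_of_nonneg)
      ultimately show ?thesis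
        unfolding tensor_apply_alpha[OF E]
        by (intro norm_triangle_le) (simp only: norm_mult norm_power norm_of_nat order_refl)
    qed
    \<comment> \<open>At \<open>i\<close> the bound \<open>le\<close> is an equality, so the degree
      term is exact while the link term can only grow. Homogeneity then extracts
      \<open>t ^ (k - 1)\<close>.\<close>
    also have "\<dots> \<le> ?D i * (t * x $ i) ^ (k - 1) + (1 - \<alpha>) * link_sum E (\<lambda>j. t * x $ j) i"
      unfolding yi using \<alpha> le
      by (intro add_left_mono mult_left_mono order_trans[OF norm_link_sum_le link_sum_mono]) auto
    also have "\<dots> = t ^ (k - 1) * (?D i * (x $ i) ^ (k - 1) + (1 - \<alpha>) * link_sum E (($) x) i)"
      by (simp add: link_sum_scale[OF E(1)] algebra_simps)
    also have "\<dots> = l * (t * x $ i) ^ (k - 1)"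
      unfolding eq by (simp add: power_mult_distrib)
    finally show ?thesis
      unfolding yi using \<open>0 < t\<close> pos[of i] by simp
  qed
  show ?thesis
    unfolding alpha_spectral_radius_def tensor_spectral_radius_def
  \<comment> \<open>An attained upper bound determines \<open>GREATEST\<close>, so existence and
    value of the maximum are settled together.\<close>
  proof (rule Greatest_equality)
    show "\<exists>m. tensor_eigenvalue k (alpha_tensor k \<alpha> E) m \<and> l = cmod m"
      using eig l unfolding tensor_eigenvalue_def by (intro exI[of _ "complex_of_real l"]) auto
  qed (use bound in \<open>auto simp: tensor_eigenvalue_def\<close>)
qed

section \<open>The form and its nonnegative maximisers\<close>

text \<open>The pairing of \<open>x\<close> with the tensor applied to \<open>x\<close>; the factor
  \<open>real k\<close> comes from Euler's identity \<open>sum_mult_link_sum\<close>.\<close>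

definition alpha_form :: "nat \<Rightarrow> real \<Rightarrow> 'v::finite set set \<Rightarrow> real^'v \<Rightarrow> real" where
  "alpha_form k \<alpha> E x = \<alpha> * (\<Sum>i\<in>UNIV. real (vertex_degree E i) * (x $ i) ^ k)
     + (1 - \<alpha>) * (real k * (\<Sum>e\<in>E. \<Prod>j\<in>e. x $ j))"

text \<open>Multiply the eigenvalue equation at \<open>i\<close> by \<open>x $ i\<close> and sum.
  This later turns a nonnegative eigenvector for the maximal value into a maximiser.\<close>

lemma alpha_form_eigenvector:
  assumes E: "uniform_hypergraph k E" "0 < k"
    and eig: "tensor_eigenvector k (alpha_tensor k \<alpha> E) (complex_of_real l) (complex_vec x)"
  shows "alpha_form k \<alpha> E x = l * (\<Sum>i\<in>UNIV. (x $ i) ^ k)"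
proof -
  have pow: "(x $ i) ^ k = x $ i * (x $ i) ^ (k - 1)" for i
    using E(2) by (cases k) auto
  have "alpha_form k \<alpha> E x = (\<Sum>i\<in>UNIV. x $ i * (\<alpha> * real (vertex_degree E i) * (x $ i) ^ (k - 1)
      + (1 - \<alpha>) * link_sum E (($) x) i))"
    unfolding alpha_form_def sum_mult_link_sum[OF E(1), symmetric] pow
    by (simp add: sum_distrib_left sum.distrib sum_subtractf algebra_simps)
  also have "\<dots> = (\<Sum>i\<in>UNIV. x $ i * (l * (x $ i) ^ (k - 1)))"
    using eig unfolding tensor_eigenvector_complex_vec_iff[OF E] by simp
  finally show ?thesis by (simp add: pow sum_distrib_left algebra_simps)
qed

text \<open>A walk from \<open>a\<close> to \<open>b\<close> has to leave \<open>Z\<close>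
  somewhere; the induction runs along the walk.\<close>

lemma connected_hypergraph_crossing_edge:
  assumes "connected_hypergraph E" "a \<in> Z" "b \<notin> Z"
  obtains e v w where "e \<in> E" "v \<in> e" "v \<in> Z" "w \<in> e" "w \<notin> Z"
proof -
  have "(a, b) \<in> {(x, y). \<exists>e\<in>E. {x, y} \<subseteq> e}\<^sup>*"
    using assms(1) by (auto simp: connected_hypergraph_def)
  then have "b \<notin> Z \<longrightarrow> (\<exists>e\<in>E. \<exists>v\<in>e. \<exists>w\<in>e. v \<in> Z \<and> w \<notin> Z)"
    by (induction rule: rtrancl_induct) (use assms(2) in auto)
  with assms(3) that show thesis by blast
qed

text \<open>Maximality is phrased as a homogeneous inequality, so the perturbed vector does not have
  to be normalised again.\<close>

lemma alpha_form_maximiser_pos: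
  fixes E :: "'v::finite set set"
  assumes E: "uniform_hypergraph k E" "connected_hypergraph E" and \<alpha>: "0 \<le> \<alpha>" "\<alpha> < 1"
    and max: "\<And>y. (\<And>i. 0 \<le> y $ i) \<Longrightarrow> alpha_form k \<alpha> E y \<le> \<mu> * (\<Sum>i\<in>UNIV. (y $ i) ^ k)"
    and x: "\<And>i. 0 \<le> x $ i" "x \<noteq> 0" "alpha_form k \<alpha> E x = \<mu> * (\<Sum>i\<in>UNIV. (x $ i) ^ k)"
  shows "0 < x $ i"
proof (rule ccontr)
  assume "\<not> 0 < x $ i"
  define Z where "Z = {i. x $ i = 0}"
  have "i \<in> Z" using \<open>\<not> 0 < x $ i\<close> x(1)[of i] by (simp add: Z_def)
  moreover obtain j where "j \<notin> Z" using x(2) by (auto simp: Z_def vec_eq_iff)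
  ultimately obtain e v w where e: "e \<in> E" "v \<in> e" "v \<in> Z" "w \<in> e" "w \<notin> Z"
    by (rule connected_hypergraph_crossing_edge[OF E(2)])
  have ck: "card e = k" using E(1) e by (simp add: uniform_hypergraph_def)
  then have k: "0 < k" using e by (auto simp: card_gt_0_iff)
  have cZ: "card (e \<inter> Z) < k"
    unfolding ck[symmetric] by (rule psubset_card_mono) (use e in auto)
  \<comment> \<open>The leading coefficient of the gain on \<open>e\<close>: entries outside
    \<open>Z\<close> stay fixed while those in \<open>Z\<close> become \<epsilon>.\<close>
  define c where "c = (\<Prod>j\<in>e - Z. x $ j)"
  have c: "0 < c"
    unfolding c_def by (rule prod_pos) (use x(1) in \<open>auto simp: Z_def less_le\<close>)
  define K where "K = (1 - \<alpha>) * (real k * c)"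
  have K: "0 < K" using \<alpha> k c by (simp add: K_def)
  \<comment> \<open>The gain is at least \<open>K * \<epsilon> ^ (k - 1)\<close> and the cost is
    \<open>\<mu> * real (card Z) * \<epsilon> ^ k\<close>. Dividing by the common power leaves a
    bound that fails for small \<epsilon>.\<close>
  have key: "K \<le> \<mu> * real (card Z) * \<epsilon>" if \<epsilon>: "0 < \<epsilon>" "\<epsilon> \<le> 1" for \<epsilon>
  proof -
    define y where "y = (\<chi> i. if i \<in> Z then \<epsilon> else x $ i)"
    have xy: "x $ i \<le> y $ i" for i using \<epsilon> by (simp add: y_def Z_def)
    have y0: "0 \<le> y $ i" for i using xy x(1) order_trans by blast
    have yk: "(y $ i) ^ k = (x $ i) ^ k + (if i \<in> Z then \<epsilon> ^ k else 0)" for i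
      using k by (auto simp: y_def Z_def)
    have sum: "(\<Sum>i\<in>UNIV. (y $ i) ^ k) = (\<Sum>i\<in>UNIV. (x $ i) ^ k) + real (card Z) * \<epsilon> ^ k"
      by (simp add: yk sum.distrib sum.If_cases)
    have "(\<Prod>j\<in>e. y $ j) = (\<Prod>j\<in>e \<inter> Z. y $ j) * (\<Prod>j\<in>e - Z. y $ j)"
      using prod.Int_Diff[of e "\<lambda>j. y $ j" Z] by simp
    also have "\<dots> = \<epsilon> ^ card (e \<inter> Z) * c"
      by (simp add: y_def c_def)
    \<comment> \<open>\<open>e\<close> has a vertex outside \<open>Z\<close>, so the exponent is at
      most \<open>k - 1\<close>, and powers of \<epsilon> decrease because \<epsilon> is at most
      1.\<close>
    also have "\<dots> \<ge> \<epsilon> ^ (k - 1) * c"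
      using \<epsilon> c cZ by (intro mult_right_mono power_decreasing) auto
    finally have ye: "\<epsilon> ^ (k - 1) * c \<le> (\<Prod>j\<in>e. y $ j)" .
    \<comment> \<open>As \<open>v\<close> lies in \<open>Z\<close>, the edge \<open>e\<close>
      contributes nothing at \<open>x\<close>, so its whole product at \<open>y\<close> is
      gain.\<close>
    have xe: "(\<Prod>j\<in>e. x $ j) = 0" using e by (auto simp: Z_def)
    have "(\<Sum>e\<in>E - {e}. \<Prod>j\<in>e. x $ j) \<le> (\<Sum>e\<in>E - {e}. \<Prod>j\<in>e. y $ j)"
      by (intro sum_mono prod_mono) (use xy x(1) in auto)
    then have "(\<Sum>e\<in>E. \<Prod>j\<in>e. x $ j) + \<epsilon> ^ (k - 1) * c \<le> (\<Sum>e\<in>E. \<Prod>j\<in>e. y $ j)"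
      using ye xe sum.remove[of E e "\<lambda>e. \<Prod>j\<in>e. x $ j"] sum.remove[of E e "\<lambda>e. \<Prod>j\<in>e. y $ j"] e(1)
      by (simp only: finite)
    moreover have "(\<Sum>i\<in>UNIV. real (vertex_degree E i) * (x $ i) ^ k)
        \<le> (\<Sum>i\<in>UNIV. real (vertex_degree E i) * (y $ i) ^ k)"
      by (intro sum_mono mult_left_mono power_mono) (use xy x(1) in auto)
    ultimately have "\<alpha> * (\<Sum>i\<in>UNIV. real (vertex_degree E i) * (x $ i) ^ k) +
        (1 - \<alpha>) * (real k * ((\<Sum>e\<in>E. \<Prod>j\<in>e. x $ j) + \<epsilon> ^ (k - 1) * c)) \<le> alpha_form k \<alpha> E y"
      unfolding alpha_form_def using \<alpha> by (intro add_mono mult_left_mono) auto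
    then have "alpha_form k \<alpha> E x + K * \<epsilon> ^ (k - 1) \<le> alpha_form k \<alpha> E y"
      by (simp add: alpha_form_def K_def algebra_simps)
    also have "\<dots> \<le> alpha_form k \<alpha> E x + \<mu> * real (card Z) * \<epsilon> ^ k"
      using max[OF y0] by (simp add: sum x(3) algebra_simps)
    finally have "K * \<epsilon> ^ (k - 1) \<le> (\<mu> * real (card Z) * \<epsilon>) * \<epsilon> ^ (k - 1)"
      using k by (cases k) (simp_all add: mult.assoc)
    then show ?thesis using \<epsilon> by simp
  qed
  \<comment> \<open>Absolute value plus 1 gives a positive bound whatever the sign of \<mu>; the
    choice of \<epsilon> then makes \<open>M * \<epsilon>\<close> at most
    \<open>K / 2\<close>.\<close>
  define M where "M = \<bar>\<mu> * real (card Z)\<bar> + 1"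
  define \<epsilon> where "\<epsilon> = min 1 (K / (2 * M))"
  have M: "0 < M" "\<mu> * real (card Z) \<le> M" by (auto simp: M_def)
  have \<epsilon>: "0 < \<epsilon>" "\<epsilon> \<le> 1" "\<epsilon> \<le> K / (2 * M)" using K M by (auto simp: \<epsilon>_def)
  have "K \<le> M * \<epsilon>"
    using key[OF \<epsilon>(1,2)] M \<epsilon> mult_right_mono[OF M(2), of \<epsilon>] by linarith
  also have "\<dots> \<le> K / 2" using \<epsilon>(3) M by (simp add: field_simps)
  finally show False using K by simp
qed

text \<open>The continuous form attains its maximum on the compact set of nonnegative vectors whose
  \<open>k\<close>-th powers sum to 1. Homogeneity of degree \<open>k\<close> extends the bound to
  all nonnegative vectors.\<close>

lemma alpha_form_maximum_exists:
  fixes E :: "'v::finite set set"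
  assumes E: "uniform_hypergraph k E" "0 < k"
  obtains \<mu> x where "\<And>i. 0 \<le> x $ i" "x \<noteq> 0" "alpha_form k \<alpha> E x = \<mu> * (\<Sum>i\<in>UNIV. (x $ i) ^ k)"
    "\<And>y. (\<And>i. 0 \<le> y $ i) \<Longrightarrow> alpha_form k \<alpha> E y \<le> \<mu> * (\<Sum>i\<in>UNIV. (y $ i) ^ k)"
proof -
  define S where "S = {x :: real^'v. (\<forall>i. 0 \<le> x $ i) \<and> (\<Sum>i\<in>UNIV. (x $ i) ^ k) = 1}"
  have "compact S"
  proof (rule compact_eq_bounded_closed[THEN iffD2], intro conjI)
    have "x $ i \<le> 1" if "x \<in> S" for x i
    proof (rule ccontr)
      assume "\<not> x $ i \<le> 1"
      then have "1 < (x $ i) ^ k" using E(2) by (intro one_less_power) auto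
      also have "\<dots> \<le> (\<Sum>i\<in>UNIV. (x $ i) ^ k)"
        by (rule member_le_sum) (use that in \<open>auto simp: S_def\<close>)
      finally show False using that by (simp add: S_def)
    qed
    then have "S \<subseteq> {vec 0 .. vec 1}" by (auto simp: S_def less_eq_vec_def)
    then show "bounded S" by (rule bounded_subset[OF bounded_closed_interval])
    show "closed S"
      unfolding S_def
      by (intro closed_Collect_conj closed_Collect_all closed_Collect_le closed_Collect_eq
          continuous_intros)
  qed
  moreover have "axis i 1 \<in> S" for i
  proof -
    have "(axis i 1 $ j) ^ k = (if j = i then 1 else (0 :: real))" for j
      using E(2) by (simp add: axis_def)
    then show ?thesis by (simp add: S_def axis_def)
  qed
  then have "S \<noteq> {}" by blast
  moreover have "continuous_on S (alpha_form k \<alpha> E)"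
    unfolding alpha_form_def by (intro continuous_intros)
  ultimately obtain x where x: "x \<in> S" "\<And>y. y \<in> S \<Longrightarrow> alpha_form k \<alpha> E y \<le> alpha_form k \<alpha> E x"
    using continuous_attains_sup by metis
  show thesis
  proof (rule that[of x "alpha_form k \<alpha> E x"])
    show "x \<noteq> 0" using x(1) E(2) by (auto simp: S_def power_0_left)
    fix y :: "real^'v" assume y: "\<And>i. 0 \<le> y $ i"
    let ?N = "\<Sum>i\<in>UNIV. (y $ i) ^ k"
    have scale: "alpha_form k \<alpha> E (s *\<^sub>R y) = s ^ k * alpha_form k \<alpha> E y" for s
    proof -
      have "(\<Sum>e\<in>E. \<Prod>j\<in>e. (s *\<^sub>R y) $ j) = s ^ k * (\<Sum>e\<in>E. \<Prod>j\<in>e. y $ j)"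
        unfolding sum_distrib_left
        by (intro sum.cong) (use E(1) in \<open>auto simp: prod.distrib uniform_hypergraph_def\<close>)
      then show ?thesis
        by (simp add: alpha_form_def power_mult_distrib sum_distrib_left algebra_simps)
    qed
    show "alpha_form k \<alpha> E y \<le> alpha_form k \<alpha> E x * ?N"
    proof (cases "?N = 0")
      case True
      then have "(y $ i) ^ k = 0" for i
        using y by (subst (asm) sum_nonneg_eq_0_iff) auto
      \<comment> \<open>In this shape the scaling identity with factor 0 gives the value 0, since
        \<open>0 < k\<close>.\<close>
      then have "y = 0 *\<^sub>R y" by (simp add: vec_eq_iff)
      then have "alpha_form k \<alpha> E y = 0" using scale[of 0] zero_power[OF E(2), where 'a = real] by simp
      with True show ?thesis by simp
    next
      case False
      then have N: "0 < ?N" using y by (simp add: sum_nonneg less_le)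
      define s where "s = root k (1 / ?N)"
      have s: "s ^ k = 1 / ?N" "0 \<le> s" using N E(2) by (auto simp: s_def)
      have "s *\<^sub>R y \<in> S"
        using s y N by (simp add: S_def power_mult_distrib flip: sum_divide_distrib)
      from x(2)[OF this] show ?thesis
        using N by (simp add: scale s field_simps)
    qed
  qed (use x(1) in \<open>auto simp: S_def\<close>)
qed

text \<open>Instead of Lagrange multipliers, one coordinate is varied in the difference \<phi> of
  the two sides of \<open>max\<close>. It is nonpositive on nonnegative vectors and vanishes at
  \<open>x\<close>; since \<open>x $ i\<close> is positive, it is an interior maximum of \<phi>, and
  the vanishing derivative is \<open>k\<close> times the eigenvalue equation.\<close>

lemma positive_maximiser_eigenvector:
  fixes E :: "'v::finite set set"
  assumes E: "uniform_hypergraph k E" "0 < k"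
    and max: "\<And>y. (\<And>i. 0 \<le> y $ i) \<Longrightarrow> alpha_form k \<alpha> E y \<le> \<mu> * (\<Sum>i\<in>UNIV. (y $ i) ^ k)"
    and x: "\<And>i. 0 < x $ i" "alpha_form k \<alpha> E x = \<mu> * (\<Sum>i\<in>UNIV. (x $ i) ^ k)"
  shows "tensor_eigenvector k (alpha_tensor k \<alpha> E) (complex_of_real \<mu>) (complex_vec x)"
  unfolding tensor_eigenvector_complex_vec_iff[OF E]
proof (intro conjI allI)
  show "x \<noteq> 0" using x(1) by (metis less_irrefl zero_index)
  fix i :: 'v
  let ?d = "\<lambda>j. real (vertex_degree E j)"
  define y where "y s = (\<chi> j. if j = i then s else x $ j)" for s
  define \<phi> where "\<phi> s = alpha_form k \<alpha> E (y s) - \<mu> * (\<Sum>j\<in>UNIV. (y s $ j) ^ k)" for s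
  define C where "C = (\<Sum>j\<in>UNIV - {i}. (\<alpha> * ?d j - \<mu>) * (x $ j) ^ k)
    + (1 - \<alpha>) * real k * (\<Sum>e | e \<in> E \<and> i \<notin> e. \<Prod>j\<in>e. x $ j)"
  \<comment> \<open>Each edge product has degree at most one in a single coordinate;
    \<open>C\<close> collects everything independent of \<open>s\<close>.\<close>
  have \<phi>: "\<phi> s = (\<alpha> * ?d i - \<mu>) * s ^ k + (1 - \<alpha>) * real k * (s * link_sum E (($) x) i) + C" for s
  proof -
    have E_split: "E = {e. e \<in> E \<and> i \<in> e} \<union> {e. e \<in> E \<and> i \<notin> e}" by auto
    have "(\<Sum>e\<in>E. \<Prod>j\<in>e. y s $ j)
        = (\<Sum>e | e \<in> E \<and> i \<in> e. \<Prod>j\<in>e. y s $ j) + (\<Sum>e | e \<in> E \<and> i \<notin> e. \<Prod>j\<in>e. y s $ j)"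
      by (subst E_split, subst sum.union_disjoint) auto
    also have "(\<Sum>e | e \<in> E \<and> i \<in> e. \<Prod>j\<in>e. y s $ j) = s * link_sum E (($) x) i"
      unfolding link_sum_def sum_distrib_left
    proof (intro sum.cong refl)
      fix e assume "e \<in> {e. e \<in> E \<and> i \<in> e}"
      then have "(\<Prod>j\<in>e. y s $ j) = s * (\<Prod>j\<in>e - {i}. y s $ j)"
        by (subst prod.remove[of e i]) (auto simp: y_def)
      also have "(\<Prod>j\<in>e - {i}. y s $ j) = (\<Prod>j\<in>e - {i}. x $ j)"
        by (rule prod.cong) (auto simp: y_def)
      finally show "(\<Prod>j\<in>e. y s $ j) = s * (\<Prod>j\<in>e - {i}. x $ j)" .
    qed
    also have "(\<Sum>e | e \<in> E \<and> i \<notin> e. \<Prod>j\<in>e. y s $ j) = (\<Sum>e | e \<in> E \<and> i \<notin> e. \<Prod>j\<in>e. x $ j)"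
      by (intro sum.cong prod.cong) (auto simp: y_def)
    finally have edges: "(\<Sum>e\<in>E. \<Prod>j\<in>e. y s $ j)
      = s * link_sum E (($) x) i + (\<Sum>e | e \<in> E \<and> i \<notin> e. \<Prod>j\<in>e. x $ j)" .
    have "(\<Sum>j\<in>UNIV. (\<alpha> * ?d j - \<mu>) * (y s $ j) ^ k)
        = (\<alpha> * ?d i - \<mu>) * s ^ k + (\<Sum>j\<in>UNIV - {i}. (\<alpha> * ?d j - \<mu>) * (y s $ j) ^ k)"
      by (subst sum.remove[of _ i]) (auto simp: y_def)
    also have "(\<Sum>j\<in>UNIV - {i}. (\<alpha> * ?d j - \<mu>) * (y s $ j) ^ k)
        = (\<Sum>j\<in>UNIV - {i}. (\<alpha> * ?d j - \<mu>) * (x $ j) ^ k)"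
      by (rule sum.cong) (auto simp: y_def)
    finally have diag: "(\<Sum>j\<in>UNIV. (\<alpha> * ?d j - \<mu>) * (y s $ j) ^ k)
      = (\<alpha> * ?d i - \<mu>) * s ^ k + (\<Sum>j\<in>UNIV - {i}. (\<alpha> * ?d j - \<mu>) * (x $ j) ^ k)" .
    have "\<phi> s = (\<Sum>j\<in>UNIV. (\<alpha> * ?d j - \<mu>) * (y s $ j) ^ k)
        + (1 - \<alpha>) * real k * (\<Sum>e\<in>E. \<Prod>j\<in>e. y s $ j)"
      by (simp add: \<phi>_def alpha_form_def sum_distrib_left sum_subtractf left_diff_distrib
          mult.assoc)
    then show ?thesis by (simp only: diag edges C_def distrib_left add_ac)
  qed
  define D where "D = (\<alpha> * ?d i - \<mu>) * (real k * (x $ i) ^ (k - 1))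
    + (1 - \<alpha>) * real k * link_sum E (($) x) i"
  have "(\<phi> has_real_derivative D) (at (x $ i))"
    unfolding \<phi>[abs_def] D_def by (auto intro!: derivative_eq_intros)
  \<comment> \<open>The radius \<open>x $ i\<close> keeps \<open>s\<close> positive, so
    \<open>y s\<close> is nonnegative and \<open>max\<close> applies.\<close>
  moreover have "\<phi> s \<le> \<phi> (x $ i)" if "\<bar>x $ i - s\<bar> < x $ i" for s
  proof -
    have "\<phi> s \<le> 0"
      unfolding \<phi>_def using that x(1) max[of "y s"] by (auto simp: y_def less_imp_le)
    moreover have "y (x $ i) = x" by (simp add: y_def vec_eq_iff)
    ultimately show ?thesis by (simp add: \<phi>_def x(2))
  qed
  ultimately have "D = 0" using x(1)[of i] by (intro DERIV_local_max[of \<phi>]) auto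
  moreover have "D = real k * (\<alpha> * ?d i * (x $ i) ^ (k - 1) + (1 - \<alpha>) * link_sum E (($) x) i
      - \<mu> * (x $ i) ^ (k - 1))"
    by (simp add: D_def algebra_simps)
  ultimately show "\<alpha> * ?d i * (x $ i) ^ (k - 1) + (1 - \<alpha>) * link_sum E (($) x) i
      = \<mu> * (x $ i) ^ (k - 1)"
    using E(2) by simp
qed

lemma perron_vector_pos:
  assumes E: "uniform_hypergraph k E" "connected_hypergraph E" "0 < k" and \<alpha>: "0 \<le> \<alpha>" "\<alpha> < 1"
    and u: "perron_vector k \<alpha> E u"
  shows "0 < u $ i"
proof -
  obtain \<mu> x where x: "\<And>i. 0 \<le> x $ i" "x \<noteq> 0"
      "alpha_form k \<alpha> E x = \<mu> * (\<Sum>i\<in>UNIV. (x $ i) ^ k)"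
    and max: "\<And>y. (\<And>i. 0 \<le> y $ i) \<Longrightarrow> alpha_form k \<alpha> E y \<le> \<mu> * (\<Sum>i\<in>UNIV. (y $ i) ^ k)"
    using alpha_form_maximum_exists[OF E(1,3)] by metis
  have pos: "0 < x $ i" for i
    using alpha_form_maximiser_pos[OF E(1,2) \<alpha> max x] .
  \<comment> \<open>The maximiser \<open>x\<close> only identifies the spectral radius with \<mu>.
    The given \<open>u\<close>, possibly a different vector, is then an eigenvector for \<mu> and
    attains the maximum too.\<close>
  have \<rho>: "alpha_spectral_radius k \<alpha> E = \<mu>"
    using positive_maximiser_eigenvector[OF E(1,3) max pos x(3)] \<alpha>
    by (intro alpha_spectral_radius_eqI[OF E(1,3) _ _ pos]) auto
  have eig: "tensor_eigenvector k (alpha_tensor k \<alpha> E) (complex_of_real \<mu>) (complex_vec u)"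
    and u0: "\<And>i. 0 \<le> u $ i"
    using u by (auto simp: perron_vector_def \<rho>)
  have "u \<noteq> 0"
    using eig by (simp add: tensor_eigenvector_complex_vec_iff[OF E(1,3)])
  then show ?thesis
    using alpha_form_maximiser_pos[OF E(1,2) \<alpha> max u0]
      alpha_form_eigenvector[OF E(1,3) eig] by blast
qed

section \<open>Edges, links and degrees of the direct product\<close>

text \<open>The two parametrisations in \<open>direct_product\<close> are the coordinate projections
  of a single list of length \<open>k\<close>, which is the form in which tensor indices
  occur.\<close>

lemma set_in_direct_product_iff:
  assumes "length ps = k"
  shows "set ps \<in> direct_product k G H \<longleftrightarrow> set (map fst ps) \<in> G \<and> set (map snd ps) \<in> H"
proof
  assume "set ps \<in> direct_product k G H"
  then obtain i j where "set ps = (\<lambda>t. (i t, j t)) ` {1..k}" "i ` {1..k} \<in> G" "j ` {1..k} \<in> H"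
    by (auto simp: direct_product_def)
  then show "set (map fst ps) \<in> G \<and> set (map snd ps) \<in> H"
    by (simp add: image_image)
next
  assume *: "set (map fst ps) \<in> G \<and> set (map snd ps) \<in> H"
  \<comment> \<open>List positions start at 0, while \<open>direct_product\<close> indexes by
    \<open>{1..k}\<close>; hence the shift.\<close>
  have "set ps = (\<lambda>t. ps ! (t - 1)) ` Suc ` {0..<k}"
    using assms by (simp add: image_image set_conv_nth atLeast0LessThan) blast
  then have ps: "set ps = (\<lambda>t. ps ! (t - 1)) ` {1..k}"
    by (simp add: image_Suc_atLeastLessThan atLeastLessThanSuc_atLeastAtMost)
  then have "fst ` (\<lambda>t. ps ! (t - 1)) ` {1..k} \<in> G" "snd ` (\<lambda>t. ps ! (t - 1)) ` {1..k} \<in> H"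
    using * by simp_all
  then show "set ps \<in> direct_product k G H"
    unfolding direct_product_def image_image
    by (intro CollectI exI[of _ "\<lambda>t. fst (ps ! (t - 1))"] exI[of _ "\<lambda>t. snd (ps ! (t - 1))"])
       (simp add: ps)
qed

lemma uniform_hypergraph_direct_product:
  assumes "uniform_hypergraph k G" "uniform_hypergraph k H"
  shows "uniform_hypergraph k (direct_product k G H)"
  unfolding uniform_hypergraph_def
proof (intro conjI ballI)
  obtain e f where ef: "e \<in> G" "f \<in> H" "card e = k" "card f = k"
    using assms by (auto simp: uniform_hypergraph_def)
  obtain xs ys where xs: "set xs = e" "length xs = k" and ys: "set ys = f" "length ys = k"
    by (metis ef(3,4) distinct_card finite_distinct_list finite)
  have "set (zip xs ys) \<in> direct_product k G H"
    by (subst set_in_direct_product_iff) (use ef xs ys in auto)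
  then show "direct_product k G H \<noteq> {}" by blast
next
  fix p assume "p \<in> direct_product k G H"
  then obtain i j where p: "p = (\<lambda>t. (i t, j t)) ` {1..k}" and "i ` {1..k} \<in> G"
    by (auto simp: direct_product_def)
  then have "card (i ` {1..k}) = card {1..k}"
    using assms by (simp add: uniform_hypergraph_def)
  \<comment> \<open>The first coordinates alone are already distinct, so the pairs are
    distinct.\<close>
  then have "inj_on i {1..k}" by (intro eq_card_imp_inj_on) auto
  then have "inj_on (\<lambda>t. (i t, j t)) {1..k}" unfolding inj_on_def prod.inject by blast
  then show "card p = k" by (simp add: p card_image)
qed

text \<open>A list of pairs is a pair of lists, so the corresponding sum over index lists splits into a product.\<close>

lemma link_sum_direct_product:
  fixes f :: "'n::finite \<Rightarrow> 'a::field_char_0" and G :: "'n set set" and H :: "'m::finite set set"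
  assumes G: "uniform_hypergraph k G" and H: "uniform_hypergraph k H" and k: "0 < k"
  shows "link_sum (direct_product k G H) (\<lambda>p. f (fst p)) (i, j)
    = fact (k - 1) * of_nat (vertex_degree H j) * link_sum G f i"
proof -
  let ?P = "{ps. length ps = k - 1 \<and> set ((i, j) # ps) \<in> direct_product k G H}"
  let ?A = "{is. length is = k - 1 \<and> set (i # is) \<in> G}"
  let ?B = "{js. length js = k - 1 \<and> set (j # js) \<in> H}"
  have mem: "set ((i, j) # ps) \<in> direct_product k G H
      \<longleftrightarrow> set (i # map fst ps) \<in> G \<and> set (j # map snd ps) \<in> H" if "length ps = k - 1" for ps
    using set_in_direct_product_iff[of "(i, j) # ps" k G H] that k by simp
  have "fact (k - 1) * link_sum (direct_product k G H) (\<lambda>p. f (fst p)) (i, j)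
      = (\<Sum>ps\<in>?P. \<Prod>p\<leftarrow>ps. f (fst p))"
    by (simp only: sum_lists_edges[OF uniform_hypergraph_direct_product[OF G H] k])
  also have "\<dots> = (\<Sum>(is, js)\<in>?A \<times> ?B. \<Prod>a\<leftarrow>is. f a)"
  proof (rule sum.reindex_bij_witness[where i = "\<lambda>(is, js). zip is js"
        and j = "\<lambda>ps. (map fst ps, map snd ps)"])
    fix ps assume "ps \<in> ?P"
    then show "(map fst ps, map snd ps) \<in> ?A \<times> ?B" using mem by auto
  next
    fix q assume "q \<in> ?A \<times> ?B"
    then obtain as bs where "q = (as, bs)" "length as = k - 1" "length bs = k - 1"
        "set (i # as) \<in> G" "set (j # bs) \<in> H"
      by blast
    then show "(case q of (is, js) \<Rightarrow> zip is js) \<in> ?P"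
      using mem[of "zip as bs"] by simp
  qed (auto simp: zip_map_fst_snd o_def)
  \<comment> \<open>\<open>f\<close> ignores the second coordinate, so the second factor merely
    counts lists and becomes a degree in \<open>H\<close>.\<close>
  also have "\<dots> = (\<Sum>is\<in>?A. \<Prod>a\<leftarrow>is. f a) * (\<Sum>js\<in>?B. \<Prod>b\<leftarrow>js. 1)"
  proof -
    have "(\<Prod>b\<leftarrow>js. 1) = (1 :: 'a)" for js :: "'m list" by (induction js) auto
    then show ?thesis by (simp only: sum_product sum.cartesian_product mult_1_right)
  qed
  \<comment> \<open>Each factor yields one \<open>fact (k - 1)\<close> and the left side carries
    one, so exactly one survives: the factorial in the final eigenvalue.\<close>
  also have "\<dots> = fact (k - 1) * (fact (k - 1) * of_nat (vertex_degree H j) * link_sum G f i)"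
    by (simp only: sum_lists_edges[OF G k] sum_lists_edges[OF H k] link_sum_1 mult_ac)
  finally show ?thesis by simp
qed

text \<open>A degree is the link sum of the constant 1, so this is a special case computed in the
  reals and pulled back to the naturals.\<close>

lemma vertex_degree_direct_product:
  fixes G :: "'n::finite set set" and H :: "'m::finite set set"
  assumes "uniform_hypergraph k G" "uniform_hypergraph k H" "0 < k"
  shows "vertex_degree (direct_product k G H) (i, j)
    = fact (k - 1) * vertex_degree H j * vertex_degree G i"
proof -
  have "real (vertex_degree (direct_product k G H) (i, j))
      = real (fact (k - 1) * vertex_degree H j * vertex_degree G i)"
    using link_sum_direct_product[OF assms, of "\<lambda>_. 1 :: real" i j] by (simp add: link_sum_1)
  then show ?thesis by (simp only: of_nat_eq_iff)
qed

theorem theorem3p3: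
  fixes k d :: nat and \<alpha> :: real
    and G :: "'n::finite set set" and H :: "'m::finite set set"
    and u :: "real^'n"
  assumes "3 \<le> k" and "0 \<le> \<alpha>" and "\<alpha> < 1"
    and "uniform_hypergraph k G" and "connected_hypergraph G"
    and "perron_vector k \<alpha> G u"
    and "uniform_hypergraph k H" and "connected_hypergraph H"
    and "regular_hypergraph d H"
  shows "alpha_spectral_radius k \<alpha> (direct_product k G H)
           = fact (k - 1) * real d * alpha_spectral_radius k \<alpha> G
    \<and> tensor_eigenvector k (alpha_tensor k \<alpha> (direct_product k G H))
        (complex_of_real (alpha_spectral_radius k \<alpha> (direct_product k G H)))
        (complex_vec (vec_tensor u (vec 1 :: real^'m)))"
proof -
  have k: "0 < k" using assms(1) by simp
  note P = uniform_hypergraph_direct_product[OF assms(4,7)]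
  let ?w = "vec_tensor u (vec 1 :: real^'m)"
  let ?c = "fact (k - 1) * real d"
  let ?\<rho> = "alpha_spectral_radius k \<alpha> G"
  have pos: "0 < u $ i" for i
    using perron_vector_pos assms k by blast
  have w: "?w $ p = u $ fst p" for p
    by (simp add: vec_tensor_def)
  then have w': "($) ?w = (\<lambda>p. u $ fst p)" by (simp add: fun_eq_iff)
  have eq: "\<alpha> * real (vertex_degree G i) * (u $ i) ^ (k - 1) + (1 - \<alpha>) * link_sum G (($) u) i
      = ?\<rho> * (u $ i) ^ (k - 1)" for i
    using assms(6) unfolding perron_vector_def tensor_eigenvector_complex_vec_iff[OF assms(4) k]
    by blast
  have eig: "tensor_eigenvector k (alpha_tensor k \<alpha> (direct_product k G H))
      (complex_of_real (?c * ?\<rho>)) (complex_vec ?w)"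
    unfolding tensor_eigenvector_complex_vec_iff[OF P k]
  proof (intro conjI allI)
    show "?w \<noteq> 0" using pos w by (metis less_irrefl zero_index)
    fix p :: "'n \<times> 'm"
    obtain i j where p: "p = (i, j)" by fastforce
    \<comment> \<open>Regularity makes the factor independent of \<open>j\<close>. Degree and link
      terms are thus scaled by the same \<open>?c\<close>, so the equation for \<open>u\<close>
      carries over for every \<alpha>.\<close>
    have "vertex_degree H j = d" using assms(9) by (simp add: regular_hypergraph_def)
    then have link: "link_sum (direct_product k G H) (($) ?w) p = ?c * link_sum G (($) u) i"
      and deg: "real (vertex_degree (direct_product k G H) p) = ?c * real (vertex_degree G i)"
      using link_sum_direct_product[OF assms(4,7) k, of "($) u" i j]
        vertex_degree_direct_product[OF assms(4,7) k, of i j]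
      unfolding w' p by simp_all
    have "\<alpha> * real (vertex_degree (direct_product k G H) p) * (?w $ p) ^ (k - 1)
        + (1 - \<alpha>) * link_sum (direct_product k G H) (($) ?w) p
        = ?c * (\<alpha> * real (vertex_degree G i) * (u $ i) ^ (k - 1)
          + (1 - \<alpha>) * link_sum G (($) u) i)"
      by (simp only: link deg w) (simp add: p algebra_simps)
    also have "\<dots> = ?c * (?\<rho> * (u $ i) ^ (k - 1))"
      by (simp only: eq)
    finally show "\<alpha> * real (vertex_degree (direct_product k G H) p) * (?w $ p) ^ (k - 1)
        + (1 - \<alpha>) * link_sum (direct_product k G H) (($) ?w) p = ?c * ?\<rho> * (?w $ p) ^ (k - 1)"
      by (simp only: w p fst_conv mult.assoc)
  qed
  \<comment> \<open>The product vector inherits positivity from \<open>u\<close>, and a positive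
    eigenvector identifies the spectral radius whether or not the product is connected.\<close>
  have "alpha_spectral_radius k \<alpha> (direct_product k G H) = ?c * ?\<rho>"
    by (rule alpha_spectral_radius_eqI[OF P k _ _ _ eig]) (use assms pos w in auto)
  with eig show ?thesis by simp
qed

end
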